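(* Let $R$ be an integral domain and $I$ a nonzero ideal of $R$. Then the $t$-integral closure $\widetilde{I}$ of $I$ is an ideal of $R$, and it is integrally closed, i.e. $\overline{\widetilde{I}}=\widetilde{I}$. In general, $\widetilde{I}$ is not $t$-closed and, a fortiori, not $t$-integrally closed: there exist an integral domain $R$ and a nonzero ideal $I$ of $R$ such that $(\widetilde{I})_t\neq \widetilde{I}$ (and hence $\widetilde{\widetilde{I}}\neq\widetilde{I}$).
   Context: All rings are commutative with identity. Let $R$ be an integral domain with quotient field $K$. For a nonzero fractional ideal $I$ of $R$, put $I^{-1}:=\{x\in K\mid xI\subseteq R\}$, $I_v:=(I^{-1})^{-1}$, and $I_t:=\bigcup J_v$, where $J$ ranges over the nonzero finitely generated subideals of $I$. The ideal $I$ is a $t$-ideal ($t$-closed) if $I_t=I$. For an ideal $I$ of $R$, the integral closure $\overline{I}$ is the set of $x\in R$ satisfying an equation $x^{n}+a_{1}x^{n-1}+\dots+a_{n-1}x+a_{n}=0$ with $n\geq 1$ and $a_i\in I^i$ for $i=1,\dots,n$; $I$ is integrally closed if $\overline{I}=I$. For a nonzero ideal $I$ of $R$, an element $x\in R$ is $t$-integral over $I$ if there is an equation $x^{n}+a_{1}x^{n-1}+\dots+a_{n-1}x+a_{n}=0$ with $n\geq 1$ and $a_{i}\in (I^{i})_{t}$ for all $i=1,\dots,n$. The $t$-integral closure $\widetilde{I}$ of $I$ is the set of all elements of $R$ that are $t$-integral over $I$; $I$ is $t$-integrally closed if $\widetilde{I}=I$. *)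

theory Defs
  imports
    "HOL-Algebra.Ideal_Product"
    "HOL-Algebra.Algebraic_Closure_Type"
    "HOL-Computational_Algebra.Formal_Laurent_Series"
begin

text \<open>
  Every integral domain embeds in a field, so an integral domain is represented by its carrier
  \<open>R :: 'k set\<close> inside an ambient field type \<open>'k\<close>, with the operations of \<open>'k\<close>. The ambient field
  may be strictly larger than the quotient field of \<open>R\<close>.
\<close>

definition ring_on :: "'k::field set \<Rightarrow> 'k ring" where
  "ring_on R = ring_of_type_algebra\<lparr>carrier := R\<rparr>"

lemma ring_on_simps [simp]:
  "carrier (ring_on R) = R"
  "x \<otimes>\<^bsub>ring_on R\<^esub> y = x * y"
  "x \<oplus>\<^bsub>ring_on R\<^esub> y = x + y"
  "\<one>\<^bsub>ring_on R\<^esub> = 1"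
  "\<zero>\<^bsub>ring_on R\<^esub> = 0"
  by (simp_all add: ring_on_def ring_of_type_algebra_def)

definition quotient_field :: "'k::field set \<Rightarrow> 'k set" where
  "quotient_field R = {a / b | a b. a \<in> R \<and> b \<in> R \<and> b \<noteq> 0}"

definition frac_inverse :: "'k::field set \<Rightarrow> 'k set \<Rightarrow> 'k set" where
  "frac_inverse R I = {x \<in> quotient_field R. \<forall>y\<in>I. x * y \<in> R}"

definition v_closure :: "'k::field set \<Rightarrow> 'k set \<Rightarrow> 'k set" where
  "v_closure R I = frac_inverse R (frac_inverse R I)"

text \<open>
  The \<open>t\<close>-closure is only needed for integral ideals \<open>I\<close> of \<open>R\<close>, whose finitely generated
  subideals are the ideals of \<open>R\<close> generated by finite subsets of \<open>I\<close>.
\<close>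

definition t_closure :: "'k::field set \<Rightarrow> 'k set \<Rightarrow> 'k set" where
  "t_closure R I =
     (\<Union>J \<in> {J. \<exists>S. finite S \<and> S \<subseteq> I \<and> J = genideal (ring_on R) S \<and> J \<noteq> {0}}. v_closure R J)"

primrec ideal_power :: "'k::field set \<Rightarrow> 'k set \<Rightarrow> nat \<Rightarrow> 'k set" where
  "ideal_power R I 0 = R"
| "ideal_power R I (Suc n) = ideal_prod (ring_on R) (ideal_power R I n) I"

definition integral_closure :: "'k::field set \<Rightarrow> 'k set \<Rightarrow> 'k set" where
  "integral_closure R I =
     {x \<in> R. \<exists>n\<ge>1. \<exists>a :: nat \<Rightarrow> 'k. (\<forall>i\<in>{1..n}. a i \<in> ideal_power R I i) \<and>
                x ^ n + (\<Sum>i=1..n. a i * x ^ (n - i)) = 0}"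

definition t_integral_closure :: "'k::field set \<Rightarrow> 'k set \<Rightarrow> 'k set" where
  "t_integral_closure R I =
     {x \<in> R. \<exists>n\<ge>1. \<exists>a :: nat \<Rightarrow> 'k. (\<forall>i\<in>{1..n}. a i \<in> t_closure R (ideal_power R I i)) \<and>
                x ^ n + (\<Sum>i=1..n. a i * x ^ (n - i)) = 0}"

end

theory Submission
  imports Defs "Jordan_Normal_Form.Char_Poly"
begin

text \<open>
  An element \<open>x\<close> is \<open>t\<close>-integral over \<open>I\<close> iff \<open>xX\<close> is integral over the Rees algebra
  \<open>\<Sum> (I\<^sup>n)\<^sub>t X\<^sup>n\<close>, so sums, multiples and integral combinations of \<open>t\<close>-integral elements are
  handled by the usual calculus of integral elements over a ring.

  For the counterexample take \<open>R = \<int> + X\<real>[[X]]\<close> and \<open>I = XR\<close>. The \<open>t\<close>-integral closure is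
  \<open>XA + X\<^sup>2\<real>[[X]]\<close> with \<open>A\<close> the ring of real algebraic integers; it contains \<open>X\<close> and \<open>\<surd>2 X\<close>.
  If \<open>q\<close> and \<open>\<surd>2 q\<close> are integers then \<open>q = 0\<close>, so the inverse of \<open>{X, \<surd>2 X}\<close> is \<open>\<real>[[X]]\<close>, whose own
  inverse \<open>X\<real>[[X]]\<close> contains \<open>X/2\<close>. But \<open>1/2\<close> is not an algebraic integer.
\<close>

section \<open>Integral elements over a subring of a field\<close>

text \<open>Closure axioms phrased with the operations of the ambient field, so that integrality can
  be treated without ring records; \<open>domain_ring_on_iff\<close> shows that these sets are
  exactly the carriers for which \<open>ring_on\<close> is a domain.\<close>

locale subring_of_field =
  fixes R :: "'k::field set"
  assumes zero_closed: "0 \<in> R"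
    and one_closed: "1 \<in> R"
    and add_closed: "x \<in> R \<Longrightarrow> y \<in> R \<Longrightarrow> x + y \<in> R"
    and uminus_closed: "x \<in> R \<Longrightarrow> - x \<in> R"
    and mult_closed: "x \<in> R \<Longrightarrow> y \<in> R \<Longrightarrow> x * y \<in> R"
begin

lemma sum_closed: "(\<And>i. i \<in> A \<Longrightarrow> f i \<in> R) \<Longrightarrow> sum f A \<in> R"
  by (induction A rule: infinite_finite_induct) (auto intro: zero_closed add_closed)

end

section \<open>Spans with coefficients in a subring\<close>

inductive_set span_over :: "'k::field set \<Rightarrow> 'k set \<Rightarrow> 'k set" for S B where
  zero: "0 \<in> span_over S B"
| add_scaled: "s \<in> S \<Longrightarrow> b \<in> B \<Longrightarrow> y \<in> span_over S B \<Longrightarrow> s * b + y \<in> span_over S B"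

lemma span_over_scaled: "s \<in> S \<Longrightarrow> b \<in> B \<Longrightarrow> s * b \<in> span_over S B"
  using span_over.add_scaled[OF _ _ span_over.zero] by fastforce

lemma span_over_add:
  assumes "x \<in> span_over S B" "y \<in> span_over S B"
  shows "x + y \<in> span_over S B"
  using assms by (induction x) (auto simp: add.assoc intro: span_over.intros)

lemma span_over_sum:
  "(\<And>i. i \<in> A \<Longrightarrow> f i \<in> span_over S B) \<Longrightarrow> sum f A \<in> span_over S B"
  by (induction A rule: infinite_finite_induct) (auto intro: span_over.zero span_over_add)

lemma span_over_finite_sum:
  assumes "subring_of_field S" "finite B" "x \<in> span_over S B"
  shows "\<exists>c. (\<forall>b\<in>B. c b \<in> S) \<and> x = (\<Sum>b\<in>B. c b * b)"
  using assms(3)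
proof induction
  case zero
  interpret subring_of_field S by fact
  show ?case by (intro exI[of _ "\<lambda>_. 0"]) (auto intro: zero_closed)
next
  case (add_scaled s b y)
  interpret subring_of_field S by fact
  from add_scaled obtain c where c: "\<forall>b\<in>B. c b \<in> S" "y = (\<Sum>b\<in>B. c b * b)" by blast
  \<comment> \<open>The new term becomes a sum over all of the finite set \<open>B\<close> with a
    single nonzero coefficient, so it merges with the coefficients already found for
    \<open>y\<close>.\<close>
  have "s * b = (\<Sum>b'\<in>B. (if b' = b then s else 0) * b')"
    using add_scaled assms(2) by (simp add: if_distrib[of "\<lambda>u. u * _"] sum.delta cong: if_cong)
  then have "s * b + y = (\<Sum>b'\<in>B. ((if b' = b then s else 0) + c b') * b')"
    by (simp add: c sum.distrib distrib_right)
  then show ?case using c add_scaled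
    by (intro exI[of _ "\<lambda>b'. (if b' = b then s else 0) + c b'"])
       (auto intro: add_closed zero_closed)
qed

lemma span_over_mult:
  assumes "subring_of_field S" "s \<in> S" "x \<in> span_over S B"
  shows "s * x \<in> span_over S B"
proof -
  interpret subring_of_field S by fact
  show ?thesis using assms(3)
  proof induction
    case (add_scaled t b y)
    then have "(s * t) * b + s * y \<in> span_over S B"
      by (intro span_over.add_scaled mult_closed assms)
    then show ?case by (simp add: algebra_simps)
  qed (simp add: span_over.zero)
qed

text \<open>Finite generation in a tower: products of generators of the two layers generate the top
  over the bottom.\<close>

lemma span_over_span_over:
  assumes "subring_of_field S"
  shows "span_over (span_over S B) C = span_over S {b * c | b c. b \<in> B \<and> c \<in> C}"
    (is "?L = ?R")
proof
  show "?L \<subseteq> ?R"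
  proof
    fix x assume "x \<in> ?L"
    then show "x \<in> ?R"
    proof induction
      case (add_scaled t c y)
      have "t * c \<in> ?R" using add_scaled(1)
      proof induction
        case zero
        then show ?case by (simp add: span_over.zero)
      next
        case (add_scaled s b u)
        then have "s * (b * c) + u * c \<in> ?R"
          using \<open>c \<in> C\<close> by (intro span_over.add_scaled) auto
        then show ?case by (simp add: algebra_simps)
      qed
      then show ?case using add_scaled by (intro span_over_add)
    qed (rule span_over.zero)
  qed
  show "?R \<subseteq> ?L"
  proof
    fix x assume "x \<in> ?R"
    then show "x \<in> ?L"
    proof induction
      case (add_scaled s d y)
      then obtain b c where d: "d = b * c" "b \<in> B" "c \<in> C" by auto
      have "(s * b) * c + y \<in> ?L"
        using add_scaled d by (intro span_over.add_scaled span_over_scaled) auto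
      then show ?case by (simp add: d algebra_simps)
    qed (rule span_over.zero)
  qed
qed

section \<open>Integral elements and the determinant trick\<close>

definition integral_over :: "'k::field set \<Rightarrow> 'k \<Rightarrow> bool" where
  "integral_over S x \<longleftrightarrow> (\<exists>n a. (\<forall>i<n. a i \<in> S) \<and> x ^ n = (\<Sum>i<n. a i * x ^ i))"

lemma integral_over_mono: "S \<subseteq> T \<Longrightarrow> integral_over S x \<Longrightarrow> integral_over T x"
  unfolding integral_over_def by blast

lemma integral_over_self: "x \<in> S \<Longrightarrow> integral_over S x"
  unfolding integral_over_def by (intro exI[of _ 1] exI[of _ "\<lambda>_. x"]) auto

text \<open>Polynomials with all coefficients in \<open>S\<close> are closed under sums and
  products, and the Leibniz formula writes the determinant as a sum of signed products of entries of
  \<open>X - A\<close>, which are such polynomials.\<close>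

lemma char_poly_coeff_closed:
  assumes "subring_of_field S" and A: "A \<in> carrier_mat n n"
    and "\<And>i j. i < n \<Longrightarrow> j < n \<Longrightarrow> A $$ (i, j) \<in> S"
  shows "coeff (char_poly A) k \<in> S"
proof -
  interpret subring_of_field S by fact
  define P where "P = {p. \<forall>k. coeff p k \<in> S}"
  have mult: "p * q \<in> P" if "p \<in> P" "q \<in> P" for p q
    using that by (auto simp: P_def coeff_mult intro: sum_closed mult_closed)
  have one: "1 \<in> P"
    by (auto simp: P_def coeff_1 one_closed zero_closed)
  have sum: "sum f Y \<in> P" if "\<And>i. i \<in> Y \<Longrightarrow> f i \<in> P" for f and Y :: "(nat \<Rightarrow> nat) set"
    using that by (auto simp: P_def coeff_sum intro: sum_closed)
  have prod: "prod f Y \<in> P" if "\<And>i. i \<in> Y \<Longrightarrow> f i \<in> P" for f and Y :: "nat set"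
    using that by (induction Y rule: infinite_finite_induct) (auto intro: one mult)
  have entry: "char_poly_matrix A $$ (i, j) \<in> P" if "i < n" "j < n" for i j
  proof -
    have "char_poly_matrix A $$ (i, j) = [:- (A $$ (i, j)), if i = j then 1 else 0:]"
      using that A by (auto simp: char_poly_matrix_def)
    then show ?thesis using assms(3)[OF that]
      by (auto simp: P_def coeff_pCons one_closed zero_closed uminus_closed split: nat.splits)
  qed
  have sign: "signof p \<in> P" for p :: "nat \<Rightarrow> nat"
    using one by (cases "evenperm p") (auto simp: P_def sign_def uminus_closed)
  have "signof p * (\<Prod>i=0..<n. char_poly_matrix A $$ (i, p i)) \<in> P"
    if "p permutes {0..<n}" for p
    using permutes_in_image[OF that] by (intro mult sign prod entry) auto
  then have "char_poly A \<in> P"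
    unfolding char_poly_def det_def'[OF char_poly_matrix_closed[OF A]] by (intro sum) blast
  then show ?thesis by (simp add: P_def)
qed

text \<open>The determinant trick: multiplication by \<open>x\<close> acts on the generators through
  a matrix over \<open>S\<close>, the vector of generators is an eigenvector for \<open>x\<close>,
  and the characteristic polynomial is the required monic equation.\<close>

lemma integral_over_if_stable_span:
  assumes "subring_of_field S" "finite B" "1 \<in> span_over S B"
    and stable: "\<And>b. b \<in> B \<Longrightarrow> x * b \<in> span_over S B"
  shows "integral_over S x"
proof -
  interpret subring_of_field S by fact
  obtain bs where bs: "set bs = B" "distinct bs"
    using finite_distinct_list[OF assms(2)] by blast
  define n where "n = length bs"
  have "\<forall>b\<in>B. \<exists>c. (\<forall>b'\<in>B. c b' \<in> S) \<and> x * b = (\<Sum>b'\<in>B. c b' * b')"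
    using span_over_finite_sum[OF assms(1,2) stable] by blast
  then obtain c where c: "\<And>b b'. b \<in> B \<Longrightarrow> b' \<in> B \<Longrightarrow> c b b' \<in> S"
    and xb: "\<And>b. b \<in> B \<Longrightarrow> x * b = (\<Sum>b'\<in>B. c b b' * b')"
    by metis
  define A where "A = mat n n (\<lambda>(i, j). c (bs ! i) (bs ! j))"
  define v where "v = vec n (\<lambda>i. bs ! i)"
  have A: "A \<in> carrier_mat n n" by (simp add: A_def)
  have v: "v \<in> carrier_vec n" by (simp add: v_def)
  have nth: "bs ! i \<in> B" if "i < n" for i
    using that bs by (auto simp: n_def)
  have bij: "bij_betw ((!) bs) {0..<n} B"
    using bs bij_betw_nth[of bs "{0..<n}" B] by (auto simp: n_def atLeast0LessThan)
  have "A *\<^sub>v v = x \<cdot>\<^sub>v v"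
  proof
    fix i assume "i < dim_vec (x \<cdot>\<^sub>v v)"
    then have i: "i < n" by (simp add: v_def)
    have "(A *\<^sub>v v) $ i = (\<Sum>j\<in>{0..<n}. c (bs ! i) (bs ! j) * bs ! j)"
      using i by (simp add: A_def v_def scalar_prod_def)
    also have "\<dots> = x * bs ! i"
      using sum.reindex_bij_betw[OF bij, of "\<lambda>b'. c (bs ! i) b' * b'"] by (simp add: xb[OF nth[OF i]])
    finally show "(A *\<^sub>v v) $ i = (x \<cdot>\<^sub>v v) $ i" using i by (simp add: v_def)
  qed (simp add: A_def v_def)
  \<comment> \<open>If all generators vanished, so would the whole span, which contains 1.\<close>
  moreover have "v \<noteq> 0\<^sub>v n"
  proof
    assume "v = 0\<^sub>v n"
    then have "bs ! i = 0" if "i < n" for i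
      using that by (auto simp: v_def dest: arg_cong[of _ _ "\<lambda>u. vec_index u i"])
    then have "B \<subseteq> {0}"
      using bs by (auto simp: n_def in_set_conv_nth)
    then have B0: "b = 0" if "b \<in> B" for b using that by blast
    have "u = 0" if "u \<in> span_over S B" for u
      using that by induction (simp_all add: B0)
    then show False using assms(3) by force
  qed
  ultimately have "eigenvalue A x"
    unfolding eigenvalue_def eigenvector_def using A v by auto
  then have "poly (char_poly A) x = 0"
    using eigenvalue_root_char_poly[OF A] by simp
  moreover have deg: "degree (char_poly A) = n" and "coeff (char_poly A) n = 1"
    using degree_monic_char_poly[OF A] by auto
  ultimately have "x ^ n + (\<Sum>i<n. coeff (char_poly A) i * x ^ i) = 0"
    by (simp add: poly_altdef lessThan_Suc_atMost[symmetric] add.commute)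
  then have "x ^ n = (\<Sum>i<n. - coeff (char_poly A) i * x ^ i)"
    by (simp add: sum_negf eq_neg_iff_add_eq_0)
  moreover have "- coeff (char_poly A) i \<in> S" for i
    using c nth by (intro uminus_closed char_poly_coeff_closed[OF assms(1) A]) (auto simp: A_def)
  ultimately show ?thesis
    unfolding integral_over_def by (intro exI[of _ n] exI[of _ "\<lambda>i. - coeff (char_poly A) i"]) auto
qed

section \<open>Module-finite extensions and transitivity of integrality\<close>

definition module_finite :: "'k::field set \<Rightarrow> 'k set \<Rightarrow> bool" where
  "module_finite S T \<longleftrightarrow> subring_of_field T \<and> S \<subseteq> T \<and> (\<exists>B. finite B \<and> T = span_over S B)"

lemma module_finite_self:
  assumes "subring_of_field S"
  shows "module_finite S S"
proof -
  interpret subring_of_field S by fact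
  have "x \<in> S" if "x \<in> span_over S {1}" for x
    using that by induction (auto intro: zero_closed add_closed)
  moreover have "x \<in> span_over S {1}" if "x \<in> S" for x
    using span_over_scaled[OF that, of 1 "{1}"] by simp
  ultimately show ?thesis
    unfolding module_finite_def using assms by (intro conjI exI[of _ "{1}"]) auto
qed

text \<open>Since \<open>T\<close> contains its finite generating set and is closed under
  multiplication by \<open>x\<close>, the determinant trick applies to these generators.\<close>

lemma module_finite_integral:
  assumes "subring_of_field S" "module_finite S T" "x \<in> T"
  shows "integral_over S x"
proof -
  from assms obtain B where B: "finite B" "T = span_over S B" and T: "subring_of_field T" "S \<subseteq> T"
    by (auto simp: module_finite_def)
  interpret S: subring_of_field S by fact
  interpret T: subring_of_field T by fact
  have "B \<subseteq> T"
    using span_over_scaled[OF S.one_closed] by (auto simp: B(2))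
  then show ?thesis
    using integral_over_if_stable_span[OF assms(1) B(1)] T.one_closed T.mult_closed[OF assms(3)] B(2)
    by blast
qed

text \<open>The extension is \<open>T[x]\<close>: an integral equation of degree \<open>n\<close>
  makes the powers of \<open>x\<close> below \<open>n\<close> generate it over \<open>T\<close>, and
  the tower lemma gives finiteness over \<open>S\<close>.\<close>

lemma module_finite_adjoin:
  assumes S: "subring_of_field S" and ST: "module_finite S T" and x: "integral_over T x"
  obtains T' where "module_finite S T'" "insert x T \<subseteq> T'"
proof -
  from ST obtain B where B: "finite B" "T = span_over S B" and T: "subring_of_field T" "S \<subseteq> T"
    by (auto simp: module_finite_def)
  interpret T: subring_of_field T by fact
  from x obtain n a where a: "\<And>i. i < n \<Longrightarrow> a i \<in> T" and xn: "x ^ n = (\<Sum>i<n. a i * x ^ i)"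
    by (auto simp: integral_over_def)
  define C where "C = (\<lambda>i. x ^ i) ` {..<n}"
  define T' where "T' = span_over T C"
  \<comment> \<open>For \<open>n = 0\<close> the equation would read 1 = 0. Positivity puts
    \<open>x ^ 0 = 1\<close> into \<open>C\<close>, so that \<open>T'\<close> contains
    \<open>T\<close>.\<close>
  have "n > 0" using xn by (cases n) auto
  then have T_T': "t \<in> T'" if "t \<in> T" for t
    using span_over_scaled[OF that, of 1 C] by (force simp: T'_def C_def)
  have scale: "t * u \<in> T'" if "t \<in> T" "u \<in> T'" for t u
    using span_over_mult[OF T(1)] that by (simp add: T'_def)
  have add: "u + w \<in> T'" if "u \<in> T'" "w \<in> T'" for u w
    using span_over_add that by (auto simp: T'_def)
  have x_mult: "x * u \<in> T'" if "u \<in> T'" for u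
    using that unfolding T'_def
  proof induction
    case (add_scaled s b y)
    then obtain i where i: "i < n" "b = x ^ i" by (auto simp: C_def)
    \<comment> \<open>Multiplying by \<open>x\<close> gives the next power in \<open>C\<close>,
      except at the top, where \<open>x ^ n\<close> is replaced by means of the equation.\<close>
    have "x * b \<in> T'"
    proof (cases "Suc i = n")
      case True
      then have "x * b = (\<Sum>i<n. a i * x ^ i)" using i xn by auto
      also have "\<dots> \<in> T'" unfolding T'_def
        by (intro span_over_sum span_over_scaled) (auto simp: a C_def)
      finally show ?thesis .
    next
      case False
      then have "x * b \<in> C" using i by (auto simp: C_def intro!: image_eqI[of _ _ "Suc i"])
      from span_over_scaled[OF T.one_closed this] show ?thesis by (simp add: T'_def)
    qed
    then have "s * (x * b) + x * y \<in> T'"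
      using add scale[OF \<open>s \<in> T\<close>] add_scaled by (simp add: T'_def)
    then show ?case by (simp add: T'_def algebra_simps)
  qed (simp add: span_over.zero)
  have pow_mult: "x ^ k * u \<in> T'" if "u \<in> T'" for k u
    using that by (induction k) (auto simp: mult.assoc intro: x_mult)
  have mult: "u * w \<in> T'" if "u \<in> T'" "w \<in> T'" for u w
    using that(1) unfolding T'_def
  proof induction
    case (add_scaled s b y)
    then obtain i where i: "b = x ^ i" by (auto simp: C_def)
    have "s * (x ^ i * w) + y * w \<in> T'"
      using add scale[OF \<open>s \<in> T\<close> pow_mult[OF that(2)]] add_scaled by (simp add: T'_def)
    then show ?case by (simp add: T'_def i algebra_simps)
  qed (simp add: span_over.zero)
  have uminus: "- u \<in> T'" if "u \<in> T'" for u
    using scale[OF T.uminus_closed[OF T.one_closed] that] by simp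
  have "subring_of_field T'"
    by unfold_locales (auto intro: T_T' T.zero_closed T.one_closed add uminus mult)
  moreover have "T' = span_over S {b * c | b c. b \<in> B \<and> c \<in> C}"
    unfolding T'_def B(2) by (rule span_over_span_over[OF S])
  moreover have "finite {b * c | b c. b \<in> B \<and> c \<in> C}"
    using B(1) by (intro finite_image_set2) (auto simp: C_def)
  ultimately have "module_finite S T'"
    unfolding module_finite_def using T(2) T_T' by blast
  moreover have "x \<in> T'" using x_mult[OF T_T'[OF T.one_closed]] by simp
  ultimately show ?thesis using that T_T' by blast
qed

lemma module_finite_adjoin_finite:
  assumes S: "subring_of_field S" and "finite Y" "\<And>x. x \<in> Y \<Longrightarrow> integral_over S x"
  shows "\<exists>T. module_finite S T \<and> Y \<subseteq> T"
  using assms(2,3)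
proof (induction Y rule: finite_induct)
  case empty
  then show ?case using module_finite_self[OF S] by blast
next
  case (insert x Y)
  then obtain T where T: "module_finite S T" "Y \<subseteq> T" by blast
  have "S \<subseteq> T" using T(1) by (simp add: module_finite_def)
  then have "integral_over T x"
    by (rule integral_over_mono) (simp add: insert.prems)
  then obtain T' where "module_finite S T'" "insert x T \<subseteq> T'"
    by (rule module_finite_adjoin[OF S T(1)])
  then show ?case using T(2) by blast
qed

text \<open>Both elements lie in one module-finite extension, all of whose elements are integral;
  the product is treated in the same way.\<close>

lemma integral_over_add:
  assumes S: "subring_of_field S" and "integral_over S x" "integral_over S y"
  shows "integral_over S (x + y)"
proof -
  obtain T where T: "module_finite S T" "{x, y} \<subseteq> T"
    using module_finite_adjoin_finite[OF S, of "{x, y}"] assms by auto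
  then interpret subring_of_field T by (simp add: module_finite_def)
  show ?thesis using T by (intro module_finite_integral[OF S T(1)] add_closed) auto
qed

lemma integral_over_mult:
  assumes S: "subring_of_field S" and "integral_over S x" "integral_over S y"
  shows "integral_over S (x * y)"
proof -
  obtain T where T: "module_finite S T" "{x, y} \<subseteq> T"
    using module_finite_adjoin_finite[OF S, of "{x, y}"] assms by auto
  then interpret subring_of_field T by (simp add: module_finite_def)
  show ?thesis using T by (intro module_finite_integral[OF S T(1)] mult_closed) auto
qed

text \<open>Adjoining the finitely many coefficients and then \<open>x\<close> keeps the extension
  finite over \<open>S\<close>.\<close>

lemma integral_over_trans:
  assumes S: "subring_of_field S" and "\<And>i. i < n \<Longrightarrow> integral_over S (a i)"
    and "x ^ n = (\<Sum>i<n. a i * x ^ i)"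
  shows "integral_over S x"
proof -
  obtain T where T: "module_finite S T" "a ` {..<n} \<subseteq> T"
    using module_finite_adjoin_finite[OF S, of "a ` {..<n}"] assms by auto
  then have "integral_over T x"
    using assms(3) unfolding integral_over_def by (intro exI[of _ n] exI[of _ a]) auto
  then obtain T' where T': "module_finite S T'" "insert x T \<subseteq> T'"
    by (rule module_finite_adjoin[OF S T(1)])
  then show ?thesis by (intro module_finite_integral[OF S T'(1)]) simp
qed

section \<open>Divisorial closure\<close>

lemma domain_ring_on_iff: "domain (ring_on R) \<longleftrightarrow> subring_of_field R"
proof
  assume "domain (ring_on R)"
  then interpret domain "ring_on R" .
  show "subring_of_field R"
  proof
    fix x assume "x \<in> R"
    then have "\<ominus>\<^bsub>ring_on R\<^esub> x \<in> R" "\<ominus>\<^bsub>ring_on R\<^esub> x + x = 0"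
      using a_inv_closed[of x] l_neg[of x] by simp_all
    then show "- x \<in> R" by (simp add: add_eq_0_iff2)
  next
    fix x y assume "x \<in> R" "y \<in> R"
    then show "x + y \<in> R" "x * y \<in> R" using a_closed[of x y] m_closed[of x y] by simp_all
  qed (use zero_closed one_closed in simp_all)
next
  assume "subring_of_field R"
  then interpret R: subring_of_field R .
  have "cring (ring_on R)"
    by (intro cringI abelian_groupI comm_monoidI)
       (auto simp: R.zero_closed R.one_closed R.add_closed R.mult_closed algebra_simps
             intro: bexI[of _ "- _"] R.uminus_closed)
  then show "domain (ring_on R)"
    by (intro domain.intro domain_axioms.intro) auto
qed

context subring_of_field
begin

lemma ring_ring_on: "ring (ring_on R)"
  using domain_ring_on_iff[of R] subring_of_field_axioms domain.axioms(1) cring.axioms(1) by blast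

lemma ideal_ring_on_iff:
  "ideal J (ring_on R) \<longleftrightarrow>
    J \<subseteq> R \<and> 0 \<in> J \<and> (\<forall>x\<in>J. \<forall>y\<in>J. x + y \<in> J) \<and> (\<forall>r\<in>R. \<forall>x\<in>J. r * x \<in> J)"
  (is "_ \<longleftrightarrow> ?rhs")
proof
  assume "ideal J (ring_on R)"
  note J = additive_subgroup.a_subset[OF ideal.axioms(1)[OF this]]
    additive_subgroup.zero_closed[OF ideal.axioms(1)[OF this]]
    additive_subgroup.a_closed[OF ideal.axioms(1)[OF this]] ideal.I_l_closed[OF this]
  show ?rhs
    using J by simp
next
  assume J: ?rhs
  \<comment> \<open>Negation is multiplication by the ring element -1.\<close>
  have uminus: "- x \<in> J" if "x \<in> J" for x
  proof -
    have "(- 1) * x \<in> J" using J that uminus_closed[OF one_closed] by blast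
    then show ?thesis by simp
  qed
  have "subgroup J (add_monoid (ring_on R))"
  proof (rule group.subgroupI)
    show "group (add_monoid (ring_on R))"
      using ring_ring_on by (intro abelian_group.a_group ring.is_abelian_group)
    fix x assume x: "x \<in> J"
    have "inv\<^bsub>add_monoid (ring_on R)\<^esub> x = - x"
      using abelian_group.minus_equality[OF ring.is_abelian_group[OF ring_ring_on], of "- x" x]
        x J uminus by (auto simp: a_inv_def)
    then show "inv\<^bsub>add_monoid (ring_on R)\<^esub> x \<in> J" using uminus[OF x] by simp
  qed (use J in auto)
  then show "ideal J (ring_on R)"
    using J by (intro idealI ring_ring_on) (simp_all, metis mult.commute)
qed

lemma genideal_subset_ideal:
  "ideal J (ring_on R) \<Longrightarrow> S \<subseteq> J \<Longrightarrow> genideal (ring_on R) S \<subseteq> J"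
  by (rule ring.genideal_minimal[OF ring_ring_on])

lemma subset_genideal: "S \<subseteq> R \<Longrightarrow> S \<subseteq> genideal (ring_on R) S"
  using ring.genideal_self[OF ring_ring_on, of S] by simp

section \<open>Arithmetic in the quotient field\<close>

lemma quotient_field_of_subring: "x \<in> R \<Longrightarrow> x \<in> quotient_field R"
  unfolding quotient_field_def using one_closed by force

lemma quotient_field_mult:
  "x \<in> quotient_field R \<Longrightarrow> y \<in> quotient_field R \<Longrightarrow> x * y \<in> quotient_field R"
proof -
  assume "x \<in> quotient_field R" "y \<in> quotient_field R"
  then obtain a b c d where *: "x = a / b" "y = c / d" "a \<in> R" "b \<in> R" "c \<in> R" "d \<in> R"
    "b \<noteq> 0" "d \<noteq> 0"
    unfolding quotient_field_def by blast
  then have "x * y = (a * c) / (b * d)" by simp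
  moreover have "a * c \<in> R" "b * d \<in> R" "b * d \<noteq> 0"
    using * by (simp_all add: mult_closed)
  ultimately show ?thesis
    unfolding quotient_field_def by blast
qed

lemma quotient_field_add:
  "x \<in> quotient_field R \<Longrightarrow> y \<in> quotient_field R \<Longrightarrow> x + y \<in> quotient_field R"
proof -
  assume "x \<in> quotient_field R" "y \<in> quotient_field R"
  then obtain a b c d where *: "x = a / b" "y = c / d" "a \<in> R" "b \<in> R" "c \<in> R" "d \<in> R"
    "b \<noteq> 0" "d \<noteq> 0"
    unfolding quotient_field_def by blast
  then have "x + y = (a * d + c * b) / (b * d)" by (simp add: add_frac_eq)
  moreover have "a * d + c * b \<in> R" "b * d \<in> R" "b * d \<noteq> 0"
    using * by (simp_all add: add_closed mult_closed)
  ultimately show ?thesis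
    unfolding quotient_field_def by blast
qed

text \<open>For fixed \<open>z\<close> the elements of \<open>R\<close> that \<open>z\<close>
  multiplies into \<open>R\<close> form an ideal; if it contains \<open>S\<close>, it contains the
  ideal generated by \<open>S\<close>. Hence closures can be computed from finite generating
  sets.\<close>

lemma frac_inverse_genideal:
  assumes "S \<subseteq> R"
  shows "frac_inverse R (genideal (ring_on R) S) = frac_inverse R S"
proof
  show "frac_inverse R (genideal (ring_on R) S) \<subseteq> frac_inverse R S"
    using subset_genideal[OF assms] by (auto simp: frac_inverse_def)
  show "frac_inverse R S \<subseteq> frac_inverse R (genideal (ring_on R) S)"
  proof
    fix z assume z: "z \<in> frac_inverse R S"
    have "ideal {y \<in> R. z * y \<in> R} (ring_on R)"
      unfolding ideal_ring_on_iff
      by (auto simp: zero_closed add_closed mult_closed distrib_left mult.left_commute)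
    moreover have "S \<subseteq> {y \<in> R. z * y \<in> R}"
      using z assms by (auto simp: frac_inverse_def)
    ultimately have "genideal (ring_on R) S \<subseteq> {y \<in> R. z * y \<in> R}"
      by (rule genideal_subset_ideal)
    then show "z \<in> frac_inverse R (genideal (ring_on R) S)"
      using z by (auto simp: frac_inverse_def)
  qed
qed

section \<open>The v-closure and the t-closure\<close>

lemma v_closure_iff:
  "x \<in> v_closure R S \<longleftrightarrow> x \<in> quotient_field R \<and> (\<forall>z\<in>frac_inverse R S. x * z \<in> R)"
  by (simp add: v_closure_def frac_inverse_def)

lemma genideal_eq_zero_iff:
  assumes "S \<subseteq> R"
  shows "genideal (ring_on R) S = {0} \<longleftrightarrow> S \<subseteq> {0}"
proof
  assume "S \<subseteq> {0}"
  moreover have "ideal {0} (ring_on R)" by (simp add: ideal_ring_on_iff zero_closed)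
  ultimately have "genideal (ring_on R) S \<subseteq> {0}" by (intro genideal_subset_ideal)
  moreover have "ideal (genideal (ring_on R) S) (ring_on R)"
    using ring.genideal_ideal[OF ring_ring_on] assms by simp
  ultimately show "genideal (ring_on R) S = {0}" by (auto simp: ideal_ring_on_iff)
qed (use subset_genideal[OF assms] in auto)

text \<open>Finitely generated ideals are traded for finite generating sets, nonzero ideals for sets
  with a nonzero element. All later work on t-closures goes through this form.\<close>

lemma t_closure_iff:
  assumes "J \<subseteq> R"
  shows "x \<in> t_closure R J \<longleftrightarrow> (\<exists>S. finite S \<and> S \<subseteq> J \<and> \<not> S \<subseteq> {0} \<and> x \<in> v_closure R S)"
proof -
  have v: "v_closure R (genideal (ring_on R) S) = v_closure R S" if "S \<subseteq> J" for S
    using that assms frac_inverse_genideal[of S] by (simp add: v_closure_def)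
  have nz: "genideal (ring_on R) S \<noteq> {0} \<longleftrightarrow> \<not> S \<subseteq> {0}" if "S \<subseteq> J" for S
    using that assms genideal_eq_zero_iff[of S] by simp
  have "x \<in> t_closure R J \<longleftrightarrow> (\<exists>S. finite S \<and> S \<subseteq> J \<and> genideal (ring_on R) S \<noteq> {0} \<and>
      x \<in> v_closure R (genideal (ring_on R) S))"
    unfolding t_closure_def by auto
  also have "\<dots> \<longleftrightarrow> (\<exists>S. finite S \<and> S \<subseteq> J \<and> \<not> S \<subseteq> {0} \<and> x \<in> v_closure R S)"
    by (intro ex_cong conj_cong refl) (simp_all only: v nz)
  finally show ?thesis .
qed

lemma t_closure_extensive:
  assumes "J \<subseteq> R" "\<not> J \<subseteq> {0}"
  shows "J \<subseteq> t_closure R J"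
proof
  fix x assume x: "x \<in> J"
  \<comment> \<open>The element \<open>y\<close> keeps the finite set \<open>{x, y}\<close>
    admissible even when \<open>x = 0\<close>.\<close>
  from assms obtain y where "y \<in> J" "y \<noteq> 0" by auto
  moreover have "x \<in> v_closure R {x, y}"
    using x assms(1) quotient_field_of_subring
    by (auto simp: v_closure_iff frac_inverse_def mult.commute)
  ultimately show "x \<in> t_closure R J"
    using x unfolding t_closure_iff[OF assms(1)] by (intro exI[of _ "{x, y}"]) auto
qed

lemma t_closure_subset: "J \<subseteq> R \<Longrightarrow> t_closure R J \<subseteq> R"
proof
  fix x assume J: "J \<subseteq> R" and "x \<in> t_closure R J"
  then obtain S where S: "S \<subseteq> J" "x \<in> v_closure R S" by (auto simp: t_closure_iff)
  moreover have "1 \<in> frac_inverse R S"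
    using S(1) J one_closed quotient_field_of_subring by (auto simp: frac_inverse_def)
  ultimately show "x \<in> R" by (auto simp: v_closure_iff)
qed

lemma v_closure_mono: "S \<subseteq> S' \<Longrightarrow> v_closure R S \<subseteq> v_closure R S'"
  unfolding v_closure_def frac_inverse_def by blast

text \<open>The finite sets witnessing the two memberships are directed: both v-closures lie in the
  v-closure of the union.\<close>

lemma t_closure_add:
  assumes J: "J \<subseteq> R" and "x \<in> t_closure R J" "y \<in> t_closure R J"
  shows "x + y \<in> t_closure R J"
proof -
  from assms obtain S S' where S: "finite S" "S \<subseteq> J" "\<not> S \<subseteq> {0}" "x \<in> v_closure R S"
    and S': "finite S'" "S' \<subseteq> J" "y \<in> v_closure R S'"
    unfolding t_closure_iff[OF J] by blast
  have "x \<in> v_closure R (S \<union> S')" "y \<in> v_closure R (S \<union> S')"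
    using S(4) S'(3) v_closure_mono[of S "S \<union> S'"] v_closure_mono[of S' "S \<union> S'"] by auto
  then have "x + y \<in> v_closure R (S \<union> S')"
    by (auto simp: v_closure_iff quotient_field_add distrib_right add_closed)
  then show ?thesis
    using S S' unfolding t_closure_iff[OF J] by (intro exI[of _ "S \<union> S'"]) auto
qed

text \<open>If \<open>z\<close> multiplies all products \<open>s * s'\<close> into \<open>R\<close>,
  then \<open>z * s'\<close> lies in the inverse of \<open>S\<close>, so \<open>x * z * s'\<close>
  is in \<open>R\<close>. Thus \<open>x * z\<close> lies in the inverse of \<open>S'\<close>, and
  \<open>y\<close> multiplies it into \<open>R\<close>.\<close>

lemma v_closure_mult:
  assumes "S' \<subseteq> R" "x \<in> v_closure R S" "y \<in> v_closure R S'"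
  shows "x * y \<in> v_closure R {s * s' | s s'. s \<in> S \<and> s' \<in> S'}"
  unfolding v_closure_iff
proof (intro conjI ballI)
  show "x * y \<in> quotient_field R"
    using assms by (auto simp: v_closure_iff intro: quotient_field_mult)
  fix z assume z: "z \<in> frac_inverse R {s * s' | s s'. s \<in> S \<and> s' \<in> S'}"
  have "x * z \<in> frac_inverse R S'"
    unfolding frac_inverse_def
  proof (intro CollectI conjI ballI)
    show "x * z \<in> quotient_field R"
      using assms z by (auto simp: v_closure_iff frac_inverse_def intro: quotient_field_mult)
  next
    fix s' assume s': "s' \<in> S'"
    have "z * s' * s \<in> R" if "s \<in> S" for s
    proof -
      have "z * (s * s') \<in> R" using z that s' unfolding frac_inverse_def by blast
      then show ?thesis by (simp add: mult_ac)
    qed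
    moreover have "z * s' \<in> quotient_field R"
      using z s' assms(1) by (auto simp: frac_inverse_def intro: quotient_field_mult quotient_field_of_subring)
    ultimately have "z * s' \<in> frac_inverse R S" by (simp add: frac_inverse_def)
    then have "x * (z * s') \<in> R" using assms(2) by (auto simp: v_closure_iff)
    then show "x * z * s' \<in> R" by (simp add: mult_ac)
  qed
  then have "y * (x * z) \<in> R" using assms(3) by (auto simp: v_closure_iff)
  then show "x * y * z \<in> R" by (simp add: mult_ac)
qed

end

section \<open>Products of t-closures and powers of ideals\<close>

context subring_of_field
begin

lemma subset_t_closure_carrier: "R \<subseteq> t_closure R R"
  using one_closed by (intro t_closure_extensive) force+

text \<open>The pairwise products of the two finite witnesses form a finite witness, nonzero because
  a field has no zero divisors. With ideal powers for \<open>J\<close>, \<open>J'\<close> and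
  \<open>L\<close> this gives the grading of the Rees algebra.\<close>

lemma t_closure_mult:
  assumes J: "J \<subseteq> R" "J' \<subseteq> R" "L \<subseteq> R" and prod: "\<And>u w. u \<in> J \<Longrightarrow> w \<in> J' \<Longrightarrow> u * w \<in> L"
    and "x \<in> t_closure R J" "y \<in> t_closure R J'"
  shows "x * y \<in> t_closure R L"
proof -
  from assms obtain S S' where S: "finite S" "S \<subseteq> J" "\<not> S \<subseteq> {0}" "x \<in> v_closure R S"
    and S': "finite S'" "S' \<subseteq> J'" "\<not> S' \<subseteq> {0}" "y \<in> v_closure R S'"
    unfolding t_closure_iff[OF J(1)] t_closure_iff[OF J(2)] by blast
  define P where "P = {s * s' | s s'. s \<in> S \<and> s' \<in> S'}"
  have "finite P" using S(1) S'(1) unfolding P_def by (intro finite_image_set2) simp_all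
  moreover have "P \<subseteq> L" using S(2) S'(2) prod by (auto simp: P_def)
  moreover have "\<not> P \<subseteq> {0}"
  proof -
    obtain s s' where "s \<in> S" "s \<noteq> 0" "s' \<in> S'" "s' \<noteq> 0" using S(3) S'(3) by auto
    then have "s * s' \<in> P" "s * s' \<noteq> 0" by (auto simp: P_def)
    then show ?thesis by blast
  qed
  moreover have "x * y \<in> v_closure R P"
    unfolding P_def using S(4) S'(2,4) J(2) by (intro v_closure_mult) auto
  ultimately show ?thesis unfolding t_closure_iff[OF J(3)] by blast
qed

lemma ideal_ideal_power:
  assumes "ideal I (ring_on R)"
  shows "ideal (ideal_power R I n) (ring_on R)"
proof (induction n)
  case 0
  then show ?case using ring.oneideal[OF ring_ring_on] by simp
next
  case (Suc n)
  then show ?case using ring.ideal_prod_is_ideal[OF ring_ring_on _ assms] by simp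
qed

lemma ideal_power_subset: "ideal I (ring_on R) \<Longrightarrow> ideal_power R I n \<subseteq> R"
  by (drule ideal_ideal_power[of I n]) (simp add: ideal_ring_on_iff)

text \<open>Induction on the second exponent, and inside it on how \<open>y\<close> is built up from
  products and sums; exponent 0 is absorption by \<open>R\<close>.\<close>

lemma ideal_power_mult:
  assumes I: "ideal I (ring_on R)" and x: "x \<in> ideal_power R I m" and "y \<in> ideal_power R I n"
  shows "x * y \<in> ideal_power R I (m + n)"
  using assms(3)
proof (induction n arbitrary: y)
  case 0
  then have "y * x \<in> ideal_power R I m"
    using ideal_ideal_power[OF I, of m] x by (simp add: ideal_ring_on_iff)
  then show ?case by (simp add: mult.commute)
next
  case (Suc n)
  from Suc.prems have "y \<in> ideal_prod (ring_on R) (ideal_power R I n) I" by simp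
  then show ?case
  proof induction
    case (prod i j)
    from ideal_prod.prod[OF Suc.IH[OF prod(1)] prod(2), of "ring_on R"]
    show ?case by (simp add: mult.assoc)
  next
    case (sum u w)
    then show ?case
      using ideal_ideal_power[OF I, of "m + Suc n"] 
      by (simp add: ideal_ring_on_iff distrib_left del: ideal_power.simps)
  qed
qed

lemma ideal_power_1:
  assumes I: "ideal I (ring_on R)"
  shows "ideal_power R I 1 = I"
proof -
  have "cring (ring_on R)"
    using domain_ring_on_iff subring_of_field_axioms domain.axioms(1) by blast
  then show ?thesis
    using cring.ideal_prod_commute[OF _ ring.oneideal[OF ring_ring_on] I]
      ring.ideal_prod_one[OF ring_ring_on I] by simp
qed

lemma power_in_ideal_power:
  assumes "u \<in> I"
  shows "u ^ n \<in> ideal_power R I n"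
proof (induction n)
  case (Suc n)
  then show ?case
    using ideal_prod.prod[of "u ^ n" "ideal_power R I n" u I "ring_on R"] assms
    by (simp add: mult.commute)
qed (simp add: one_closed)

lemma ideal_power_nonzero:
  assumes I: "ideal I (ring_on R)" "I \<noteq> {0}"
  shows "\<not> ideal_power R I n \<subseteq> {0}"
proof -
  obtain u where u: "u \<in> I" "u \<noteq> 0" using I by (auto simp: ideal_ring_on_iff)
  then show ?thesis using power_in_ideal_power[OF u(1), of n] by auto
qed

end

section \<open>The Rees algebra of a graded family\<close>

text \<open>The conditions under which the series with \<open>n\<close>-th coefficient in
  \<open>F n\<close> form a ring. The application takes for \<open>F n\<close> the t-closure of the
  \<open>n\<close>-th power of \<open>I\<close>.\<close>

locale graded_family =
  fixes F :: "nat \<Rightarrow> 'k::field set"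
  assumes zero_closed: "0 \<in> F n"
    and one_closed: "1 \<in> F 0"
    and add_closed: "x \<in> F n \<Longrightarrow> y \<in> F n \<Longrightarrow> x + y \<in> F n"
    and uminus_closed: "x \<in> F n \<Longrightarrow> - x \<in> F n"
    and mult_closed: "x \<in> F m \<Longrightarrow> y \<in> F n \<Longrightarrow> x * y \<in> F (m + n)"

text \<open>Power series instead of polynomials are harmless here, because only one homogeneous
  component of an integral equation is ever used; Laurent series serve as a field containing them.\<close>

definition rees :: "(nat \<Rightarrow> 'k::field set) \<Rightarrow> 'k fls set" where
  "rees F = {fps_to_fls f | f. \<forall>n. fps_nth f n \<in> F n}"

text \<open>The monomial \<open>x X^d\<close>, viewed in the field of Laurent series.\<close>

definition homog :: "nat \<Rightarrow> 'k::field \<Rightarrow> 'k fls" where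
  "homog d x = fps_to_fls (fps_const x * fps_X ^ d)"

lemma fps_to_fls_sum: "fps_to_fls (sum f A) = (\<Sum>i\<in>A. fps_to_fls (f i))"
  by (induction A rule: infinite_finite_induct) simp_all

lemma fps_nth_const_mult_X_power:
  "fps_nth (fps_const x * fps_X ^ d) n = (if n = d then x else 0)"
  by (simp add: fps_X_power_nth)

lemma homog_mult: "homog d x * homog e y = homog (d + e) (x * y)"
  unfolding homog_def fls_times_fps_to_fls[symmetric]
  by (simp add: power_add mult_ac flip: fps_const_mult)

lemma homog_add: "homog d x + homog d y = homog d (x + y)"
  by (simp add: homog_def distrib_right flip: fps_to_fls_plus fps_const_add)

lemma homog_zero: "homog d 0 = 0"
  by (simp add: homog_def)

lemma homog_sum: "(\<Sum>i\<in>A. homog d (f i)) = homog d (sum f A)"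
  by (induction A rule: infinite_finite_induct) (simp_all add: homog_zero homog_add)

lemma homog_power: "homog d x ^ n = homog (n * d) (x ^ n)"
  by (induction n) (simp_all add: homog_mult, simp add: homog_def)

text \<open>Translates between two indexings: ideal-theoretic equations number coefficients by their
  degree, \<open>integral_over\<close> by the power of \<open>x\<close> that they multiply.\<close>

lemma sum_reverse_degree: "(\<Sum>i=1..n. f i) = (\<Sum>i<n. f (n - i))" for f :: "nat \<Rightarrow> 'b::comm_monoid_add"
  by (rule sum.reindex_bij_witness[of _ "\<lambda>i. n - i" "\<lambda>i. n - i"]) auto

text \<open>The equation is multiplied by \<open>X^n\<close>, the factor \<open>X^i\<close> going to
  the coefficient \<open>a i\<close>, and all lower terms move to the other side, whence the
  sign.\<close>

lemma homogeneous_equation: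
  fixes x :: "'k::field"
  assumes "x ^ n + (\<Sum>i=1..n. a i * x ^ (n - i)) = 0"
  shows "homog 1 x ^ n = (\<Sum>i<n. homog (n - i) (- a (n - i)) * homog 1 x ^ i)"
proof -
  have "homog (n - i) (- a (n - i)) * homog 1 x ^ i = homog n (- (a (n - i) * x ^ i))" if "i < n" for i
    using that by (simp add: homog_power homog_mult)
  then have "(\<Sum>i<n. homog (n - i) (- a (n - i)) * homog 1 x ^ i) = homog n (- (\<Sum>i<n. a (n - i) * x ^ i))"
    by (simp add: homog_sum sum_negf)
  also have "(\<Sum>i<n. a (n - i) * x ^ i) = (\<Sum>i=1..n. a i * x ^ (n - i))"
    unfolding sum_reverse_degree by (intro sum.cong) auto
  also have "homog n (- \<dots>) = homog 1 x ^ n"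
    using assms by (simp add: homog_power add_eq_0_iff)
  finally show ?thesis by simp
qed

context graded_family
begin

lemma sum_closed: "(\<And>i. i \<in> A \<Longrightarrow> f i \<in> F n) \<Longrightarrow> sum f A \<in> F n"
  by (induction A rule: infinite_finite_induct) (auto intro: zero_closed add_closed)

lemma homog_in_rees: "x \<in> F d \<Longrightarrow> homog d x \<in> rees F"
  unfolding rees_def homog_def
  using zero_closed by (auto simp: fps_nth_const_mult_X_power simp del: fps_mult_left_const_nth)

lemma subring_rees: "subring_of_field (rees F)"
proof
  show "0 \<in> rees F"
    unfolding rees_def by (auto intro!: exI[of _ 0] zero_closed)
  show "1 \<in> rees F"
    using homog_in_rees[OF one_closed] by (simp add: homog_def)
next
  fix u w assume "u \<in> rees F" "w \<in> rees F"
  then obtain f g where fg: "u = fps_to_fls f" "w = fps_to_fls g"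
    "\<And>n. fps_nth f n \<in> F n" "\<And>n. fps_nth g n \<in> F n"
    unfolding rees_def by blast
  then have "u + w = fps_to_fls (f + g)" "u * w = fps_to_fls (f * g)"
    by (simp_all add: fls_times_fps_to_fls)
  moreover have "fps_nth (f + g) n \<in> F n" for n
    using fg by (simp add: add_closed)
  moreover have "fps_nth (f * g) n \<in> F n" for n
  proof -
    \<comment> \<open>Each term of the Cauchy product has total degree
      \<open>i + (n - i) = n\<close>.\<close>
    have "fps_nth f i * fps_nth g (n - i) \<in> F n" if "i \<le> n" for i
      using mult_closed[OF fg(3,4), of i "n - i"] that by simp
    then show ?thesis by (auto simp: fps_mult_nth intro: sum_closed)
  qed
  ultimately show "u + w \<in> rees F" "u * w \<in> rees F"
    unfolding rees_def by blast+
next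
  fix u assume "u \<in> rees F"
  then obtain f where f: "u = fps_to_fls f" "\<And>n. fps_nth f n \<in> F n"
    unfolding rees_def by blast
  then have "- u = fps_to_fls (- f)" "\<And>n. fps_nth (- f) n \<in> F n"
    by (simp_all add: uminus_closed)
  then show "- u \<in> rees F" unfolding rees_def by blast
qed

text \<open>From left to right, compare coefficients of \<open>X^n\<close>: the term with the
  \<open>i\<close>-th power of \<open>xX\<close> contributes only the coefficient of degree
  \<open>n - i\<close> of its factor. The converse homogenises the equation.\<close>

lemma integral_over_rees_iff:
  "integral_over (rees F) (homog 1 x) \<longleftrightarrow>
    (\<exists>n\<ge>1. \<exists>a. (\<forall>i\<in>{1..n}. a i \<in> F i) \<and> x ^ n + (\<Sum>i=1..n. a i * x ^ (n - i)) = 0)"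
proof
  assume "integral_over (rees F) (homog 1 x)"
  then obtain n c where c: "\<And>i. i < n \<Longrightarrow> c i \<in> rees F"
    and eq: "homog 1 x ^ n = (\<Sum>i<n. c i * homog 1 x ^ i)"
    unfolding integral_over_def by blast
  from c have "\<forall>i. \<exists>f. i < n \<longrightarrow> c i = fps_to_fls f \<and> (\<forall>k. fps_nth f k \<in> F k)"
    unfolding rees_def by blast
  then obtain f where f: "\<And>i. i < n \<Longrightarrow> c i = fps_to_fls (f i)"
    and fF: "\<And>i k. i < n \<Longrightarrow> fps_nth (f i) k \<in> F k"
    by metis
  have power: "homog 1 x ^ i = fps_to_fls (fps_const (x ^ i) * fps_X ^ i)" for i
    unfolding homog_power by (simp add: homog_def)
  have summand: "c i * homog 1 x ^ i = fps_to_fls (f i * (fps_const (x ^ i) * fps_X ^ i))"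
    if "i < n" for i
    by (simp only: f[OF that] power fls_times_fps_to_fls)
  have "fps_to_fls (fps_const (x ^ n) * fps_X ^ n) = homog 1 x ^ n"
    by (simp only: power)
  also have "\<dots> = fps_to_fls (\<Sum>i<n. f i * (fps_const (x ^ i) * fps_X ^ i))"
    unfolding eq fps_to_fls_sum by (rule sum.cong[OF refl], rule summand, simp)
  finally have "fps_const (x ^ n) * fps_X ^ n = (\<Sum>i<n. f i * (fps_const (x ^ i) * fps_X ^ i))"
    by (simp only: fps_to_fls_eq_iff)
  then have "x ^ n = (\<Sum>i<n. fps_nth (f i * (fps_const (x ^ i) * fps_X ^ i)) n)"
    by (metis (no_types, lifting) fps_nth_const_mult_X_power fps_sum_nth sum.cong)
  also have "\<dots> = (\<Sum>i<n. fps_nth (f i) (n - i) * x ^ i)"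
    by (intro sum.cong) (auto simp: mult.assoc[symmetric] fps_X_power_mult_right_nth)
  also have "\<dots> = (\<Sum>i=1..n. fps_nth (f (n - i)) i * x ^ (n - i))"
    unfolding sum_reverse_degree by (intro sum.cong) auto
  finally have "x ^ n + (\<Sum>i=1..n. - fps_nth (f (n - i)) i * x ^ (n - i)) = 0"
    by (simp add: sum_negf)
  \<comment> \<open>For \<open>n = 0\<close> the equation just derived reads 1 = 0.\<close>
  moreover from this have "n \<noteq> 0" by (intro notI) simp
  ultimately show "\<exists>n\<ge>1. \<exists>a. (\<forall>i\<in>{1..n}. a i \<in> F i) \<and> x ^ n + (\<Sum>i=1..n. a i * x ^ (n - i)) = 0"
    using fF uminus_closed
    by (intro exI[of _ n] conjI exI[of _ "\<lambda>i. - fps_nth (f (n - i)) i"]) auto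
next
  assume "\<exists>n\<ge>1. \<exists>a. (\<forall>i\<in>{1..n}. a i \<in> F i) \<and> x ^ n + (\<Sum>i=1..n. a i * x ^ (n - i)) = 0"
  then obtain n a where a: "\<And>i. i \<in> {1..n} \<Longrightarrow> a i \<in> F i"
    and eq: "x ^ n + (\<Sum>i=1..n. a i * x ^ (n - i)) = 0" by blast
  have "homog (n - i) (- a (n - i)) \<in> rees F" if "i < n" for i
    using that by (intro homog_in_rees uminus_closed a) auto
  then show "integral_over (rees F) (homog 1 x)"
    unfolding integral_over_def
    by (intro exI[of _ n] exI[of _ "\<lambda>i. homog (n - i) (- a (n - i))"] conjI
          homogeneous_equation[OF eq]) auto
qed

end

section \<open>The \<open>t\<close>-integral closure\<close>

context subring_of_field
begin

lemma graded_family_t_closure: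
  assumes I: "ideal I (ring_on R)" "I \<noteq> {0}"
  shows "graded_family (\<lambda>n. t_closure R (ideal_power R I n))" (is "graded_family ?F")
proof
  note sub = ideal_power_subset[OF I(1)]
  have ext: "ideal_power R I n \<subseteq> ?F n" for n
    by (intro t_closure_extensive sub ideal_power_nonzero[OF I])
  show mult: "x * y \<in> ?F (m + n)" if "x \<in> ?F m" "y \<in> ?F n" for x y m n
    by (rule t_closure_mult[OF sub sub sub ideal_power_mult[OF I(1)] that])
  show "0 \<in> ?F n" for n
    using ext ideal_ideal_power[OF I(1), of n] by (auto simp: ideal_ring_on_iff)
  show "1 \<in> ?F 0"
    using ext[of 0] one_closed by auto
  show "x + y \<in> ?F n" if "x \<in> ?F n" "y \<in> ?F n" for x y n
    using that by (rule t_closure_add[OF sub])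
  \<comment> \<open>Negation is obtained as multiplication by -1 in degree 0, which leaves the
    degree unchanged.\<close>
  have "- 1 \<in> ?F 0"
    using ext[of 0] uminus_closed[OF one_closed] by auto
  from mult[OF this] show "- x \<in> ?F n" if "x \<in> ?F n" for x n
    using that by fastforce
qed

lemma t_integral_closure_iff:
  assumes "ideal I (ring_on R)" "I \<noteq> {0}"
  shows "x \<in> t_integral_closure R I \<longleftrightarrow>
    x \<in> R \<and> integral_over (rees (\<lambda>n. t_closure R (ideal_power R I n))) (homog 1 x)"
  using graded_family.integral_over_rees_iff[OF graded_family_t_closure[OF assms]]
  by (simp add: t_integral_closure_def)

text \<open>Sums of integral elements of degree 1 are integral of degree 1; a ring multiplier acts
  as a constant of the Rees algebra.\<close>

lemma ideal_t_integral_closure: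
  assumes I: "ideal I (ring_on R)" "I \<noteq> {0}"
  shows "ideal (t_integral_closure R I) (ring_on R)"
proof -
  define S where "S = rees (\<lambda>n. t_closure R (ideal_power R I n))"
  interpret F: graded_family "\<lambda>n. t_closure R (ideal_power R I n)"
    by (rule graded_family_t_closure[OF I])
  have S: "subring_of_field S" unfolding S_def by (rule F.subring_rees)
  note iff = t_integral_closure_iff[OF I, folded S_def]
  have "0 \<in> t_integral_closure R I"
    using integral_over_self[OF subring_of_field.zero_closed[OF S]]
    by (simp add: iff zero_closed homog_zero)
  moreover have "x + y \<in> t_integral_closure R I"
    if "x \<in> t_integral_closure R I" "y \<in> t_integral_closure R I" for x y
    using that integral_over_add[OF S, of "homog 1 x" "homog 1 y"]
    by (simp add: iff add_closed homog_add)
  moreover have "r * x \<in> t_integral_closure R I" if "r \<in> R" "x \<in> t_integral_closure R I" for r x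
  proof -
    \<comment> \<open>The zeroth power of \<open>I\<close> is \<open>R\<close>, so \<open>r\<close>
      sits in degree 0.\<close>
    have "r \<in> t_closure R (ideal_power R I 0)"
      using subset_t_closure_carrier that(1) by auto
    then have "integral_over S (homog 0 r)"
      unfolding S_def by (intro integral_over_self F.homog_in_rees)
    then have "integral_over S (homog 1 (r * x))"
      using integral_over_mult[OF S, of "homog 0 r" "homog 1 x"] that(2) by (simp add: iff homog_mult)
    then show ?thesis using that by (simp add: iff mult_closed)
  qed
  moreover have "t_integral_closure R I \<subseteq> R" by (auto simp: iff)
  ultimately show ?thesis by (simp add: ideal_ring_on_iff)
qed

text \<open>The degree-one equation \<open>x + (- x) = 0\<close> suffices.\<close>

lemma integral_closure_extensive:
  assumes "ideal J (ring_on R)"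
  shows "J \<subseteq> integral_closure R J"
proof
  fix x assume x: "x \<in> J"
  have "(- 1) * x \<in> J"
    using assms x uminus_closed[OF one_closed] unfolding ideal_ring_on_iff by blast
  then have "- x \<in> ideal_power R J 1"
    unfolding ideal_power_1[OF assms] by simp
  moreover have "x \<in> R" using assms x by (auto simp: ideal_ring_on_iff)
  ultimately show "x \<in> integral_closure R J"
    unfolding integral_closure_def
    by (intro CollectI conjI exI[of _ "1 :: nat"] exI[of _ "\<lambda>_. - x"]) auto
qed

text \<open>Here \<open>xX\<close> already lies in the Rees algebra. The inclusion makes failure of
  t-closedness imply failure of t-integral closedness.\<close>

lemma t_closure_subset_t_integral_closure:
  assumes I: "ideal I (ring_on R)" "I \<noteq> {0}"
  shows "t_closure R I \<subseteq> t_integral_closure R I"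
proof
  fix x assume "x \<in> t_closure R I"
  then have "x \<in> t_closure R (ideal_power R I 1)" "x \<in> R"
    using t_closure_subset[of I] I(1) unfolding ideal_power_1[OF I(1)]
    by (auto simp: ideal_ring_on_iff)
  then show "x \<in> t_integral_closure R I"
    unfolding t_integral_closure_iff[OF I]
    by (intro conjI integral_over_self graded_family.homog_in_rees[OF graded_family_t_closure[OF I]])
qed

text \<open>In an integral equation over the t-integral closure, each homogenised coefficient is
  itself integral over the Rees algebra; transitivity then makes \<open>xX\<close> integral over
  it.\<close>

lemma integral_closure_t_integral_closure:
  assumes I: "ideal I (ring_on R)" "I \<noteq> {0}"
  shows "integral_closure R (t_integral_closure R I) = t_integral_closure R I"
proof
  define S where "S = rees (\<lambda>n. t_closure R (ideal_power R I n))"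
  interpret F: graded_family "\<lambda>n. t_closure R (ideal_power R I n)"
    by (rule graded_family_t_closure[OF I])
  have S: "subring_of_field S" unfolding S_def by (rule F.subring_rees)
  note iff = t_integral_closure_iff[OF I, folded S_def]
  \<comment> \<open>An element of the \<open>i\<close>-th power is built by sums from products of
    \<open>i\<close> factors \<open>u\<close>, each with \<open>uX\<close> integral, and a ring
    element in the case \<open>i = 0\<close>.\<close>
  have power: "integral_over S (homog i x)" if "x \<in> ideal_power R (t_integral_closure R I) i" for i x
    using that
  proof (induction i arbitrary: x)
    case 0
    then have "x \<in> t_closure R (ideal_power R I 0)"
      using subset_t_closure_carrier by auto
    then show ?case
      unfolding S_def by (intro integral_over_self F.homog_in_rees)
  next
    case (Suc i)
    from Suc.prems
    have "x \<in> ideal_prod (ring_on R) (ideal_power R (t_integral_closure R I) i) (t_integral_closure R I)"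
      by simp
    then show ?case
    proof induction
      case (prod u w)
      then show ?case
        using integral_over_mult[OF S, of "homog i u" "homog 1 w"] Suc.IH by (simp add: iff homog_mult)
    next
      case (sum u w)
      then show ?case
        using integral_over_add[OF S, of "homog (Suc i) u" "homog (Suc i) w"] by (simp add: homog_add)
    qed
  qed
  have neg: "integral_over S (homog i (- x))" if "integral_over S (homog i x)" for i x
  proof -
    have "- 1 \<in> S"
      using subring_of_field.uminus_closed[OF S] subring_of_field.one_closed[OF S] by blast
    from integral_over_mult[OF S integral_over_self[OF this] that] show ?thesis
      by (simp add: homog_def flip: fps_const_neg)
  qed
  show "integral_closure R (t_integral_closure R I) \<subseteq> t_integral_closure R I"
  proof
    fix x assume "x \<in> integral_closure R (t_integral_closure R I)"
    then obtain n a where x: "x \<in> R"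
      and a: "\<And>i. i \<in> {1..n} \<Longrightarrow> a i \<in> ideal_power R (t_integral_closure R I) i"
      and eq: "x ^ n + (\<Sum>i=1..n. a i * x ^ (n - i)) = 0"
      unfolding integral_closure_def by blast
    have "integral_over S (homog (n - i) (- a (n - i)))" if "i < n" for i
      using that by (intro neg power a) simp
    then have "integral_over S (homog 1 x)"
      using integral_over_trans[OF S _ homogeneous_equation[OF eq]] by blast
    then show "x \<in> t_integral_closure R I" using x by (simp add: iff)
  qed
  show "t_integral_closure R I \<subseteq> integral_closure R (t_integral_closure R I)"
    by (intro integral_closure_extensive ideal_t_integral_closure I)
qed

end

section \<open>A \<open>t\<close>-integral closure that is not \<open>t\<close>-closed\<close>

text \<open>A principal ideal bounds t-closures: \<open>1 / c\<close> lies in the inverse of every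
  finite subset of \<open>J\<close>. It is applied with \<open>c\<close> a power of
  \<open>X\<close>.\<close>

lemma (in subring_of_field) t_closure_subset_principal:
  assumes "c \<in> R" "c \<noteq> 0" "J \<subseteq> R" "\<And>x. x \<in> J \<Longrightarrow> x / c \<in> R" "x \<in> t_closure R J"
  shows "x / c \<in> R"
proof -
  from assms obtain S where S: "S \<subseteq> J" "x \<in> v_closure R S"
    unfolding t_closure_iff[OF assms(3)] by blast
  have "1 / c \<in> quotient_field R"
    using assms(1,2) one_closed unfolding quotient_field_def by blast
  then have "1 / c \<in> frac_inverse R S"
    using S(1) assms(4) by (auto simp: frac_inverse_def)
  then show ?thesis using S(2) by (auto simp: v_closure_iff)
qed

section \<open>The ring Z + X R[[X]] and the ideal generated by X\<close>

definition int_const_ring :: "real fls set" where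
  "int_const_ring = {fps_to_fls f | f. fps_nth f 0 \<in> \<int>}"

definition X_ideal :: "real fls set" where
  "X_ideal = {fls_X * u | u. u \<in> int_const_ring}"

interpretation int_const_ring: subring_of_field int_const_ring
proof
  show "0 \<in> int_const_ring"
    unfolding int_const_ring_def by (auto intro!: exI[of _ 0])
  show "1 \<in> int_const_ring"
    unfolding int_const_ring_def by (auto intro!: exI[of _ 1])
next
  fix u w assume "u \<in> int_const_ring" "w \<in> int_const_ring"
  then obtain f g where fg: "u = fps_to_fls f" "w = fps_to_fls g" "fps_nth f 0 \<in> \<int>" "fps_nth g 0 \<in> \<int>"
    unfolding int_const_ring_def by blast
  then have "u + w = fps_to_fls (f + g)" "u * w = fps_to_fls (f * g)"
    by (simp_all add: fls_times_fps_to_fls)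
  moreover have "fps_nth (f + g) 0 \<in> \<int>" "fps_nth (f * g) 0 \<in> \<int>"
    using fg by simp_all
  ultimately show "u + w \<in> int_const_ring" "u * w \<in> int_const_ring"
    unfolding int_const_ring_def by blast+
next
  fix u assume "u \<in> int_const_ring"
  then obtain f where f: "u = fps_to_fls f" "fps_nth f 0 \<in> \<int>"
    unfolding int_const_ring_def by blast
  then have "- u = fps_to_fls (- f)" "fps_nth (- f) 0 \<in> \<int>"
    by simp_all
  then show "- u \<in> int_const_ring" unfolding int_const_ring_def by blast
qed

lemma X_mult_const_in_int_const_ring: "fls_X * fls_const c \<in> int_const_ring"
proof -
  have "fls_X * fls_const c = fps_to_fls (fps_X * fps_const c)"
    by (simp add: fls_times_fps_to_fls)
  moreover have "fps_nth (fps_X * fps_const c) 0 \<in> \<int>" by simp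
  ultimately show ?thesis unfolding int_const_ring_def by blast
qed

lemma X_in_int_const_ring: "fls_X \<in> int_const_ring"
  using X_mult_const_in_int_const_ring[of 1] by simp

lemma X_in_X_ideal: "fls_X \<in> X_ideal"
  unfolding X_ideal_def using int_const_ring.one_closed by force

lemma X_power_in_int_const_ring: "fls_X ^ n \<in> int_const_ring"
  by (induction n)
     (simp_all add: int_const_ring.one_closed int_const_ring.mult_closed X_in_int_const_ring)

lemma ideal_X_ideal: "ideal X_ideal (ring_on int_const_ring)"
  unfolding int_const_ring.ideal_ring_on_iff
proof (intro conjI ballI)
  show "X_ideal \<subseteq> int_const_ring"
    by (auto simp: X_ideal_def intro: int_const_ring.mult_closed X_in_int_const_ring)
  show "0 \<in> X_ideal"
    unfolding X_ideal_def using int_const_ring.zero_closed by force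
next
  fix x y assume "x \<in> X_ideal" "y \<in> X_ideal"
  then obtain u w where "x = fls_X * u" "y = fls_X * w" "u \<in> int_const_ring" "w \<in> int_const_ring"
    by (auto simp: X_ideal_def)
  then show "x + y \<in> X_ideal"
    unfolding X_ideal_def using int_const_ring.add_closed
    by (auto intro!: exI[of _ "u + w"] simp: distrib_left)
next
  fix r x assume "r \<in> int_const_ring" "x \<in> X_ideal"
  then obtain u where "x = fls_X * u" "u \<in> int_const_ring" "r \<in> int_const_ring"
    by (auto simp: X_ideal_def)
  then show "r * x \<in> X_ideal"
    unfolding X_ideal_def using int_const_ring.mult_closed
    by (auto intro!: exI[of _ "r * u"] simp: mult.left_commute)
qed

lemma X_ideal_nonzero: "X_ideal \<noteq> {0}"
  using X_in_X_ideal by (metis fls_X_nonzero singletonD)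

text \<open>Every factor from the ideal supplies one factor \<open>X\<close>.\<close>

lemma ideal_power_X_ideal: "x \<in> ideal_power int_const_ring X_ideal n \<Longrightarrow> x / fls_X ^ n \<in> int_const_ring"
proof (induction n arbitrary: x)
  case (Suc n)
  from Suc.prems
  have "x \<in> ideal_prod (ring_on int_const_ring) (ideal_power int_const_ring X_ideal n) X_ideal"
    by simp
  then show ?case
  proof induction
    case (prod i j)
    then obtain w where "j = fls_X * w" "w \<in> int_const_ring" by (auto simp: X_ideal_def)
    \<comment> \<open>Cancels the single \<open>X\<close> contributed by \<open>j\<close>; it is
      used at \<open>c = fls_X\<close>.\<close>
    moreover have "i * (c * w) / c ^ Suc n = i / c ^ n * w" if "c \<noteq> 0" for c :: "real fls"
      using that by simp
    ultimately show ?case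
      using int_const_ring.mult_closed[OF Suc.IH[OF prod(1)], of w]
      by (simp only: fls_X_nonzero ring_on_simps not_False_eq_True)
  qed (simp add: add_divide_distrib int_const_ring.add_closed)
qed simp

lemma t_closure_ideal_power_X_ideal:
  "x \<in> t_closure int_const_ring (ideal_power int_const_ring X_ideal n) \<Longrightarrow>
    x / fls_X ^ n \<in> int_const_ring"
  by (rule int_const_ring.t_closure_subset_principal[OF X_power_in_int_const_ring _
        int_const_ring.ideal_power_subset[OF ideal_X_ideal] ideal_power_X_ideal]) auto

section \<open>Membership in the t-integral closure of the ideal\<close>

lemma sqrt2_X_in_closure: "fls_X * fls_const (sqrt 2) \<in> t_integral_closure int_const_ring X_ideal"
proof -
  interpret F: graded_family "\<lambda>n. t_closure int_const_ring (ideal_power int_const_ring X_ideal n)"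
    by (rule int_const_ring.graded_family_t_closure[OF ideal_X_ideal X_ideal_nonzero])
  \<comment> \<open>The equation is \<open>x^2 - 2 X^2 = 0\<close>. Writing \<open>2 X^2\<close> as
    a sum lets its membership follow from closure under addition and negation; all other
    coefficients are 0.\<close>
  define a :: "nat \<Rightarrow> real fls" where "a = (\<lambda>i. if i = 2 then - (fls_X ^ 2 + fls_X ^ 2) else 0)"
  have X2: "fls_X ^ 2 \<in> t_closure int_const_ring (ideal_power int_const_ring X_ideal 2)"
    using int_const_ring.t_closure_extensive[OF
        int_const_ring.ideal_power_subset[OF ideal_X_ideal]
        int_const_ring.ideal_power_nonzero[OF ideal_X_ideal X_ideal_nonzero]]
      int_const_ring.power_in_ideal_power[OF X_in_X_ideal] by blast
  have "a i \<in> t_closure int_const_ring (ideal_power int_const_ring X_ideal i)" for i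
    using F.uminus_closed[OF F.add_closed[OF X2 X2]] F.zero_closed
    by (cases "i = 2") (simp_all only: a_def if_True if_False refl)
  moreover have "(fls_X * fls_const (sqrt 2)) ^ 2 + (\<Sum>i=1..2. a i * (fls_X * fls_const (sqrt 2)) ^ (2 - i)) = 0"
  proof -
    have "fls_const (sqrt 2) * fls_const (sqrt 2) = (1 + 1 :: real fls)"
      by (simp only: fls_const_mult_const) (simp flip: fls_plus_const)
    then have "(fls_X * fls_const (sqrt 2)) ^ 2 = fls_X ^ 2 + (fls_X :: real fls) ^ 2"
      unfolding power_mult_distrib by (simp add: power2_eq_square[of "fls_const _"] distrib_left)
    then show ?thesis by (simp add: a_def numeral_2_eq_2)
  qed
  ultimately show ?thesis
    unfolding t_integral_closure_def using X_mult_const_in_int_const_ring[of "sqrt 2"]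
    by (intro CollectI conjI exI[of _ "2 :: nat"] exI[of _ a]) auto
qed

lemma X_in_closure: "fls_X \<in> t_integral_closure int_const_ring X_ideal"
  using int_const_ring.t_closure_subset_t_integral_closure[OF ideal_X_ideal X_ideal_nonzero]
    int_const_ring.t_closure_extensive[of X_ideal] ideal_X_ideal X_in_X_ideal
  by (force simp: int_const_ring.ideal_ring_on_iff)

text \<open>Multiplied by \<open>2 ^ n\<close>, the equation says that 1 plus an even integer is
  0.\<close>

lemma half_no_integral_equation:
  fixes z :: "nat \<Rightarrow> real"
  assumes "\<And>i. i \<in> {1..n} \<Longrightarrow> z i \<in> \<int>"
  shows "(1 / 2) ^ n + (\<Sum>i=1..n. z i * (1 / 2) ^ (n - i)) \<noteq> 0"
proof
  assume eq: "(1 / 2) ^ n + (\<Sum>i=1..n. z i * (1 / 2) ^ (n - i)) = 0"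
  have "\<forall>i\<in>{1..n}. \<exists>m. z i = of_int m" using assms by (blast elim: Ints_cases)
  then obtain m where m: "\<And>i. i \<in> {1..n} \<Longrightarrow> z i = of_int (m i)" by metis
  have "2 ^ n * (z i * (1 / 2) ^ (n - i)) = of_int (m i * 2 ^ i)" if "i \<in> {1..n}" for i
  proof -
    have "(2::real) ^ n = 2 ^ i * 2 ^ (n - i)" using that by (simp flip: power_add)
    then show ?thesis using m[OF that] by (simp add: power_divide)
  qed
  then have "0 = 1 + (\<Sum>i=1..n. of_int (m i * 2 ^ i) :: real)"
    using arg_cong[OF eq, of "\<lambda>u. 2 ^ n * u"]
    by (simp add: distrib_left sum_distrib_left power_divide)
  also have "\<dots> = of_int (1 + (\<Sum>i=1..n. m i * 2 ^ i))" by simp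
  finally have "1 + (\<Sum>i=1..n. m i * 2 ^ i) = 0" by linarith
  \<comment> \<open>The index starts at 1, so each \<open>2 ^ i\<close> is even.\<close>
  moreover have "even (\<Sum>i=1..n. m i * 2 ^ i)"
    by (intro dvd_sum) auto
  ultimately show False by presburger
qed

text \<open>Each \<open>a i\<close> is \<open>X^i\<close> times a series with integral constant
  term. Dividing an equation for \<open>X/2\<close> by \<open>X^n\<close> and taking constant terms
  would make 1/2 an algebraic integer.\<close>

lemma half_X_not_in_closure:
  "fls_X * fls_const (1 / 2) \<notin> t_integral_closure int_const_ring X_ideal"
proof
  define x :: "real fls" where "x = fls_X * fls_const (1 / 2)"
  assume "fls_X * fls_const (1 / 2) \<in> t_integral_closure int_const_ring X_ideal"
  then obtain n a where
    a: "\<And>i. i \<in> {1..n} \<Longrightarrow> a i \<in> t_closure int_const_ring (ideal_power int_const_ring X_ideal i)"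
    and eq: "x ^ n + (\<Sum>i=1..n. a i * x ^ (n - i)) = 0"
    unfolding t_integral_closure_def x_def by blast
  have "\<forall>i\<in>{1..n}. \<exists>f. a i / fls_X ^ i = fps_to_fls f \<and> fps_nth f 0 \<in> \<int>"
    using t_closure_ideal_power_X_ideal[OF a] unfolding int_const_ring_def by blast
  then obtain f where f: "\<And>i. i \<in> {1..n} \<Longrightarrow> a i / fls_X ^ i = fps_to_fls (f i)"
    and f0: "\<And>i. i \<in> {1..n} \<Longrightarrow> fps_nth (f i) 0 \<in> \<int>"
    by metis
  have power: "x ^ k = fls_X ^ k * fps_to_fls (fps_const ((1 / 2) ^ k))" for k
    by (induction k) (simp_all add: x_def mult_ac)
  have summand: "a i * x ^ (n - i) = fls_X ^ n * fps_to_fls (f i * fps_const ((1 / 2) ^ (n - i)))"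
    if i: "i \<in> {1..n}" for i
  proof -
    have "a i = fps_to_fls (f i) * fls_X ^ i" 
      using f[OF i] nonzero_divide_eq_eq[of "fls_X ^ i" "a i" "fps_to_fls (f i)"]
      by (metis fls_X_nonzero power_not_zero)
    moreover have "(fls_X :: real fls) ^ n = fls_X ^ i * fls_X ^ (n - i)"
      using i by (simp flip: power_add)
    ultimately show ?thesis
      unfolding power fls_times_fps_to_fls by (simp only: mult_ac)
  qed
  have "0 = fls_X ^ n * fps_to_fls (fps_const ((1 / 2) ^ n) + (\<Sum>i=1..n. f i * fps_const ((1 / 2) ^ (n - i))))"
    using eq unfolding power[of n] fps_to_fls_plus fps_to_fls_sum distrib_left sum_distrib_left
    by (simp only: summand cong: sum.cong)
  then have "fps_const ((1 / 2) ^ n) + (\<Sum>i=1..n. f i * fps_const ((1 / 2) ^ (n - i))) = 0"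
    by (metis fls_X_nonzero fps_to_fls_eq_0_iff mult_eq_0_iff power_not_zero)
  from arg_cong[OF this, of "\<lambda>g. fps_nth g 0"]
  have "(1 / 2) ^ n + (\<Sum>i=1..n. fps_nth (f i) 0 * (1 / 2) ^ (n - i)) = 0"
    by (simp add: fps_sum_nth)
  then show False using half_no_integral_equation[of n "\<lambda>i. fps_nth (f i) 0", OF f0] by blast
qed

section \<open>The t-closure contains X/2\<close>

lemma sqrt2_mult_Ints:
  assumes "t \<in> \<int>" "sqrt 2 * t \<in> \<int>"
  shows "t = 0"
proof (rule ccontr)
  assume "t \<noteq> 0"
  \<comment> \<open>A nonzero \<open>t\<close> would make \<open>sqrt 2\<close> rational; being an
    algebraic integer it would be an integer, yet it lies strictly between 1 and 2.\<close>
  then have "sqrt 2 = (sqrt 2 * t) / t" by simp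
  also have "\<dots> \<in> \<rat>" using assms Ints_subset_Rats by (intro Rats_divide) auto
  finally have "sqrt 2 \<in> \<int>"
    by (rule rational_algebraic_int_is_int[rotated]) (auto intro: algebraic_int_sqrt)
  then obtain m where "sqrt 2 = of_int m" by (elim Ints_cases)
  moreover have "1 < sqrt 2" "sqrt 2 < 2" by (auto simp: real_less_lsqrt)
  ultimately show False by auto
qed

lemma half_X_in_v_closure:
  "fls_X * fls_const (1 / 2) \<in> v_closure int_const_ring {fls_X, fls_X * fls_const (sqrt 2)}"
  unfolding int_const_ring.v_closure_iff
proof (intro conjI ballI)
  show "fls_X * fls_const (1 / 2) \<in> quotient_field int_const_ring"
    by (intro int_const_ring.quotient_field_of_subring X_mult_const_in_int_const_ring)
  fix z assume "z \<in> frac_inverse int_const_ring {fls_X, fls_X * fls_const (sqrt 2)}"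
  then have "z * fls_X \<in> int_const_ring" "z * (fls_X * fls_const (sqrt 2)) \<in> int_const_ring"
    by (auto simp: frac_inverse_def)
  then obtain f g where fg: "z * fls_X = fps_to_fls f" "z * (fls_X * fls_const (sqrt 2)) = fps_to_fls g"
    "fps_nth f 0 \<in> \<int>" "fps_nth g 0 \<in> \<int>"
    unfolding int_const_ring_def by blast
  \<comment> \<open>The second generator is \<open>sqrt 2\<close> times the first, so
    \<open>f\<close> and \<open>sqrt 2\<close> times \<open>f\<close> both have integral constant
    terms. Hence that of \<open>f\<close> is 0, and halving \<open>f\<close> stays in the
    ring.\<close>
  have "fps_to_fls g = fps_to_fls (f * fps_const (sqrt 2))"
    unfolding fg(2)[symmetric] by (simp add: fls_times_fps_to_fls flip: fg(1) mult.assoc)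
  then have "g = f * fps_const (sqrt 2)" by (simp only: fps_to_fls_eq_iff)
  then have "fps_nth f 0 = 0"
    using fg(3,4) by (intro sqrt2_mult_Ints) (simp_all add: mult.commute)
  moreover have "fls_X * fls_const (1 / 2) * z = fps_to_fls (f * fps_const (1 / 2))"
    by (simp add: fls_times_fps_to_fls mult_ac flip: fg(1))
  ultimately show "fls_X * fls_const (1 / 2) * z \<in> int_const_ring"
    unfolding int_const_ring_def by (intro CollectI exI[of _ "f * fps_const (1 / 2)"]) auto
qed

lemma half_X_in_t_closure:
  "fls_X * fls_const (1 / 2) \<in> t_closure int_const_ring (t_integral_closure int_const_ring X_ideal)"
proof -
  have "t_integral_closure int_const_ring X_ideal \<subseteq> int_const_ring"
    by (auto simp: t_integral_closure_def)
  then show ?thesis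
    using half_X_in_v_closure X_in_closure sqrt2_X_in_closure
    by (subst int_const_ring.t_closure_iff)
       (auto intro!: exI[of _ "{fls_X, fls_X * fls_const (sqrt 2)}"])
qed

theorem theorem3p2:
  shows "(\<forall>(R :: 'k::field set) I.
            domain (ring_on R) \<and> ideal I (ring_on R) \<and> I \<noteq> {0} \<longrightarrow>
              ideal (t_integral_closure R I) (ring_on R) \<and>
              integral_closure R (t_integral_closure R I) = t_integral_closure R I) \<and>
         (\<exists>(R :: real fls set) I.
            domain (ring_on R) \<and> ideal I (ring_on R) \<and> I \<noteq> {0} \<and>
              t_closure R (t_integral_closure R I) \<noteq> t_integral_closure R I \<and>
              t_integral_closure R (t_integral_closure R I) \<noteq> t_integral_closure R I)"
proof (intro conjI allI impI)
  fix R I :: "'k set"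
  assume *: "domain (ring_on R) \<and> ideal I (ring_on R) \<and> I \<noteq> {0}"
  then interpret subring_of_field R by (simp add: domain_ring_on_iff)
  show "ideal (t_integral_closure R I) (ring_on R)"
    using * by (intro ideal_t_integral_closure) auto
  show "integral_closure R (t_integral_closure R I) = t_integral_closure R I"
    using * by (intro integral_closure_t_integral_closure) auto
next
  let ?C = "t_integral_closure int_const_ring X_ideal"
  \<comment> \<open>Needed to apply the inclusion of the t-closure in the t-integral closure to
    \<open>?C\<close> itself; \<open>X/2\<close> then witnesses both inequalities.\<close>
  have "?C \<noteq> {0}" using X_in_closure by auto
  then have "t_closure int_const_ring ?C \<subseteq> t_integral_closure int_const_ring ?C"
    by (intro int_const_ring.t_closure_subset_t_integral_closure
        int_const_ring.ideal_t_integral_closure ideal_X_ideal X_ideal_nonzero)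
  then have "t_integral_closure int_const_ring ?C \<noteq> ?C" "t_closure int_const_ring ?C \<noteq> ?C"
    using half_X_in_t_closure half_X_not_in_closure by auto
  then show "\<exists>(R :: real fls set) I.
            domain (ring_on R) \<and> ideal I (ring_on R) \<and> I \<noteq> {0} \<and>
              t_closure R (t_integral_closure R I) \<noteq> t_integral_closure R I \<and>
              t_integral_closure R (t_integral_closure R I) \<noteq> t_integral_closure R I"
    using ideal_X_ideal X_ideal_nonzero int_const_ring.subring_of_field_axioms
    by (intro exI[of _ int_const_ring] exI[of _ X_ideal]) (simp add: domain_ring_on_iff)
qed

end
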